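(* Let $\alpha^\bot$ be the root of $$(1-\alpha^\bot)\ln(1-\alpha^\bot)+(2-1/\mathrm{e})(1-2\alpha^\bot)=0$$ satisfying $\alpha^\bot>0.405$. Then the MGreedy algorithm achieves an approximation factor of $\alpha^\bot$: for every instance of the problem, its output $S_{\mathrm m}$ satisfies $c(S_{\mathrm m})\le b$ and $f(S_{\mathrm m})\ge \alpha^\bot\cdot f(\mathrm{OPT})$, where $\mathrm{OPT}$ is an optimal solution.
   Context: Problem: $V$ is a finite ground set; $f:2^V\to\mathbb{R}$ is monotone nondecreasing ($f(S)\le f(T)$ for $S\subseteq T$), submodular ($f(S)+f(T)\ge f(S\cup T)+f(S\cap T)$), and normalized ($f(\emptyset)=0$). Each element $v$ has a cost $c(v)>0$, $c(S)=\sum_{v\in S}c(v)$, and the budget $b$ satisfies $c(v)\le b$ for all $v$. The problem is $\max_{S\subseteq V} f(S)$ subject to $c(S)\le b$; $\mathrm{OPT}$ denotes an optimal solution. Write $f(v\mid S)=f(S\cup\{v\})-f(S)$. MGreedy: set $S_{\mathrm g}\gets\emptyset$, $V'\gets V$. While $V'\ne\emptyset$: pick $u\in V'$ maximizing $f(u\mid S_{\mathrm g})/c(u)$ (ties arbitrary); if $c(S_{\mathrm g})+c(u)\le b$ set $S_{\mathrm g}\gets S_{\mathrm g}\cup\{u\}$; then remove $u$ from $V'$. Afterwards let $v^*\in\arg\max_{v\in V}f(\{v\})$ and output $S_{\mathrm m}$, whichever of $\{v^*\}$ and $S_{\mathrm g}$ has the larger $f$-value. *)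

theory Defs
  imports Complex_Main
begin

definition submodular_on :: "'a set \<Rightarrow> ('a set \<Rightarrow> real) \<Rightarrow> bool" where
  "submodular_on V f \<longleftrightarrow> (\<forall>S T. S \<subseteq> V \<longrightarrow> T \<subseteq> V \<longrightarrow> f S + f T \<ge> f (S \<union> T) + f (S \<inter> T))"

definition marginal :: "('a set \<Rightarrow> real) \<Rightarrow> 'a \<Rightarrow> 'a set \<Rightarrow> real" where
  "marginal f v S = f (S \<union> {v}) - f S"

definition optimal_solution ::
    "'a set \<Rightarrow> ('a set \<Rightarrow> real) \<Rightarrow> ('a \<Rightarrow> real) \<Rightarrow> real \<Rightarrow> 'a set \<Rightarrow> bool" where
  "optimal_solution V f c b X \<longleftrightarrow> is_arg_max f (\<lambda>S. S \<subseteq> V \<and> sum c S \<le> b) X"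

text \<open>One iteration of the while loop on states \<open>(S\<^sub>g, V')\<close>. It is a relation rather than a
  function because ties between maximizers are broken arbitrarily. No step is possible from
  a state with \<open>V' = {}\<close>.\<close>

inductive mgreedy_step ::
    "('a set \<Rightarrow> real) \<Rightarrow> ('a \<Rightarrow> real) \<Rightarrow> real \<Rightarrow> 'a set \<times> 'a set \<Rightarrow> 'a set \<times> 'a set \<Rightarrow> bool"
  for f c b where
  "is_arg_max (\<lambda>v. marginal f v S / c v) (\<lambda>v. v \<in> V') u \<Longrightarrow>
   mgreedy_step f c b (S, V') (if sum c S + c u \<le> b then S \<union> {u} else S, V' - {u})"

text \<open>\<open>mgreedy_output V f c b X\<close>: some run of MGreedy outputs \<open>X\<close>. The outer \<open>is_arg_max\<close>
  selects the better of \<open>{v\<^sup>*}\<close> and \<open>S\<^sub>g\<close>, either one if their values agree.\<close>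

definition mgreedy_output ::
    "'a set \<Rightarrow> ('a set \<Rightarrow> real) \<Rightarrow> ('a \<Rightarrow> real) \<Rightarrow> real \<Rightarrow> 'a set \<Rightarrow> bool" where
  "mgreedy_output V f c b X \<longleftrightarrow>
     (\<exists>Sg v. (mgreedy_step f c b)\<^sup>*\<^sup>* ({}, V) (Sg, {}) \<and>
             is_arg_max (\<lambda>v. f {v}) (\<lambda>v. v \<in> V) v \<and>
             is_arg_max f (\<lambda>S. S \<in> {{v}, Sg}) X)"

text \<open>The bound \<open>a < 1\<close> is the domain of \<open>ln (1 - a)\<close>; it has to be explicit because \<open>ln\<close> is
  total in HOL. The root in this interval exists and is unique, see \<open>alpha_bot_ex1\<close>.\<close>

definition alpha_bot :: real where
  "alpha_bot = (THE a. 0.405 < a \<and> a < 1 \<and>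
     (1 - a) * ln (1 - a) + (2 - 1 / exp 1) * (1 - 2 * a) = 0)"

lemma exp_ge_partial_sum:
  fixes x :: real
  assumes "0 \<le> x"
  shows "(\<Sum>k<n. x ^ k / fact k) \<le> exp x"
proof -
  have "(\<lambda>k. x ^ k / fact k) sums exp x"
    using exp_converges[of x] by (simp add: scaleR_conv_of_real divide_inverse mult.commute)
  then show ?thesis
    using sum_le_suminf[of "\<lambda>k. x ^ k / fact k" "{..<n}"] assms
    by (auto simp: sums_iff)
qed

lemma alpha_bot_ex1:
  "\<exists>!a::real. 0.405 < a \<and> a < 1 \<and>
     (1 - a) * ln (1 - a) + (2 - 1 / exp 1) * (1 - 2 * a) = 0"
proof -
  define g :: "real \<Rightarrow> real"
    where "g a = (1 - a) * ln (1 - a) + (2 - 1 / exp 1) * (1 - 2 * a)" for a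
  have "2.71 \<le> exp (1::real)"
    using exp_ge_partial_sum[of 1 6] by (simp add: lessThan_nat_numeral fact_numeral)
  then have e: "1 / exp 1 \<le> (0.37::real)" by (simp add: field_simps)
  have "1.681 \<le> exp (0.52::real)"
    using exp_ge_partial_sum[of "0.52" 5]
    by (simp add: lessThan_nat_numeral fact_numeral power_divide)
  then have "exp (-0.52) \<le> (0.595::real)" by (simp add: exp_minus field_simps)
  then have "ln (0.595::real) \<ge> -0.52" by (subst ln_ge_iff) auto
  then have l: "ln (119 / 200 :: real) \<ge> - 13 / 25" by simp
  have "g 0.405 = 119 / 200 * ln (119 / 200) + (2 - 1 / exp 1) * (19 / 100)"
    unfolding g_def by simp
  moreover have "1 / exp 1 \<le> (37 / 100 :: real)" using e by simp
  ultimately have g1: "g 0.405 > 0" using l by argo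
  have gneg: "g a < 0" if "0.5 \<le> a" "a < 1" for a
  proof -
    have "(1 - a) * ln (1 - a) < 0" using that by (intro mult_pos_neg) auto
    moreover have "(2 - 1 / exp 1) * (1 - 2 * a) \<le> 0"
      using that e by (intro mult_nonneg_nonpos) auto
    ultimately show ?thesis unfolding g_def by linarith
  qed
  have deriv: "(g has_real_derivative (- ln (1 - a) - 1 - 2 * (2 - 1 / exp 1))) (at a)"
    if "a < 1" for a
    unfolding g_def using that by (auto intro!: derivative_eq_intros)
  have cont: "\<forall>a. 0.405 \<le> a \<and> a \<le> 0.5 \<longrightarrow> isCont g a"
  proof (intro allI impI)
    fix a :: real assume "0.405 \<le> a \<and> a \<le> 0.5"
    then have "a < 1" by simp
    then show "isCont g a" by (rule DERIV_isCont[OF deriv])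
  qed
  have "\<exists>a. 0.405 \<le> a \<and> a \<le> 0.5 \<and> g a = 0"
    by (rule IVT2[OF _ _ _ cont]) (use g1 gneg[of "0.5"] in simp_all)
  then obtain a0 where a0: "0.405 \<le> a0" "a0 \<le> 0.5" "g a0 = 0" by blast
  have dec: "g y < g x" if "x < y" "y < 0.5" for x y
  proof (rule DERIV_neg_imp_decreasing[OF that(1)])
    fix a assume "x \<le> a" "a \<le> y"
    then have a: "a < 0.5" using that by simp
    have "ln (1 - a) > ln (0.5)" using a by (subst ln_less_cancel_iff) auto
    moreover have "ln (0.5::real) \<ge> -1"
    proof -
      have "exp (-1) \<le> (0.5::real)" using e unfolding exp_minus inverse_eq_divide by (rule order_trans) simp
      then show ?thesis by (subst ln_ge_iff) auto
    qed
    ultimately have "- ln (1 - a) - 1 - 2 * (2 - 1 / exp 1) < 0" using e by simp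
    moreover have "a < 1" using a by simp
    ultimately show "\<exists>d. DERIV g a :> d \<and> d < 0" using deriv by blast
  qed
  have "\<exists>!a. 0.405 < a \<and> a < 1 \<and> g a = 0"
  proof
    show "0.405 < a0 \<and> a0 < 1 \<and> g a0 = 0"
      using a0 g1 by (cases "a0 = 0.405") auto
    fix a assume a: "0.405 < a \<and> a < 1 \<and> g a = 0"
    then have "a < 0.5" using gneg[of a] by (cases "0.5 \<le> a") auto
    moreover have "a0 < 0.5" using gneg[of "0.5"] a0 by (cases "a0 = 0.5") auto
    ultimately show "a = a0"
      using dec[of a a0] dec[of a0 a] a a0(3) by (metis less_irrefl linorder_less_linear)
  qed
  then show ?thesis unfolding g_def .
qed

lemma is_arg_max_finite_ex:
  fixes g :: "'a \<Rightarrow> real"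
  assumes "finite A" "A \<noteq> {}"
  shows "\<exists>x. is_arg_max g (\<lambda>x. x \<in> A) x"
proof -
  obtain x where x: "x \<in> A" "g x = Max (g ` A)"
    using Max_in[of "g ` A"] assms by fastforce
  have "g y \<le> g x" if "y \<in> A" for y
    using x(2) that assms(1) by simp
  with x(1) show ?thesis by (auto simp: is_arg_max_def not_less)
qed

lemma mgreedy_loop_ex:
  assumes "finite W"
  shows "\<exists>Sg. (mgreedy_step f c b)\<^sup>*\<^sup>* (S, W) (Sg, {})"
  using assms
proof (induction "card W" arbitrary: S W)
  case 0
  then show ?case by auto
next
  case (Suc n)
  then have ne: "W \<noteq> {}" by auto
  obtain u where u: "is_arg_max (\<lambda>v. marginal f v S / c v) (\<lambda>v. v \<in> W) u"
    using is_arg_max_finite_ex[OF Suc.prems ne] by blast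
  then have uW: "u \<in> W" by (simp add: is_arg_max_def)
  have "n = card (W - {u})" using Suc.hyps(2) Suc.prems uW by simp
  then obtain Sg where
    "(mgreedy_step f c b)\<^sup>*\<^sup>* (if sum c S + c u \<le> b then S \<union> {u} else S, W - {u}) (Sg, {})"
    using Suc.hyps(1) Suc.prems by blast
  then show ?case
    using mgreedy_step.intros[OF u] by (meson converse_rtranclp_into_rtranclp)
qed

lemma mgreedy_output_ex:
  assumes "finite V" "V \<noteq> {}"
  shows "\<exists>X. mgreedy_output V f c b X"
proof -
  obtain Sg where "(mgreedy_step f c b)\<^sup>*\<^sup>* ({}, V) (Sg, {})"
    using mgreedy_loop_ex[OF assms(1)] by blast
  moreover obtain v where "is_arg_max (\<lambda>v. f {v}) (\<lambda>v. v \<in> V) v"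
    using is_arg_max_finite_ex[OF assms, of "\<lambda>v. f {v}"] by blast
  moreover obtain X where "is_arg_max f (\<lambda>S. S \<in> {{v}, Sg}) X"
    using is_arg_max_finite_ex[of "{{v}, Sg}" f] by blast
  ultimately show ?thesis unfolding mgreedy_output_def by blast
qed

lemma optimal_solution_ex:
  assumes "finite V" "0 \<le> b"
  shows "\<exists>X. optimal_solution V f c b X"
proof -
  define A where "A = {S. S \<subseteq> V \<and> sum c S \<le> b}"
  have "{} \<in> A" "finite A" using assms by (simp_all add: A_def)
  then have "\<exists>X. is_arg_max f (\<lambda>S. S \<in> A) X"
    by (intro is_arg_max_finite_ex) blast+
  then show ?thesis unfolding optimal_solution_def A_def by simp
qed

end

theory Submission
  imports Defs
begin

text \<open>Every element added by the greedy loop increases \<open>f\<close> at a rate (gain per cost) of at least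
  \<open>(f T - f S) / c(T)\<close>, for each set \<open>T\<close> none of whose elements has been rejected so far. Take
  \<open>b = f OPT = 1\<close> and suppose that the output has value less than \<open>\<alpha> = 0.406\<close>, which is slightly
  more than \<open>alpha_bot\<close>. Let \<open>u\<close> and \<open>w\<close> be the first two elements of \<open>OPT\<close> that are rejected, from
  the greedy sets \<open>A\<close> and \<open>A'\<close>.
  The rate with respect to \<open>OPT\<close> gives \<open>1 - c(u) < c(A) < 0.521\<close>. The rate with respect to
  \<open>OPT - {u}\<close>, a set of value at least \<open>1 - \<alpha>\<close> and cost at most \<open>1 - c(u)\<close>, gives
  \<open>1 - c(w) < c(A') < 1.151 (1 - c(u))\<close>, hence \<open>c(w) > 0.4\<close>. So the set \<open>OPT - {u, w}\<close>, whose value is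
  at least \<open>1 - 2 \<alpha>\<close>, is cheap: its cost \<open>z\<close> satisfies \<open>z + 0.4 < c(A)\<close>. Using the rate with
  respect to it up to cost \<open>z\<close> and then the rate with respect to \<open>OPT\<close> gives
  \<open>1 - f A \<le> (1 - (1 - 1/e) (1 - 2 \<alpha>)) exp (-0.4) < 1 - \<alpha>\<close>, a contradiction.\<close>

section \<open>Numerical estimates\<close>

lemma exp_one_ge: "(2.7174::real) \<le> exp 1"
  using exp_ge_partial_sum[of 1 7] by (simp add: lessThan_nat_numeral fact_numeral)

lemma exp_0_4_ge: "(1.484::real) \<le> exp 0.4"
  using exp_ge_partial_sum[of "0.4" 5]
  by (simp add: lessThan_nat_numeral fact_numeral power_divide)

text \<open>Here 0.594 = 1 - 0.406, and 0.521 slightly exceeds \<open>- ln 0.594\<close>; this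
  bounds the greedy cost at the first rejection.\<close>

lemma exp_0_521_ge: "(1 / 0.594::real) \<le> exp 0.521"
  using exp_ge_partial_sum[of "0.521" 7]
  by (simp add: lessThan_nat_numeral fact_numeral power_divide)

text \<open>Here 0.188 = 1 - 2 * 0.406, and 1.151 slightly exceeds
  \<open>ln (0.594 / 0.188)\<close>; this bounds the greedy cost at the second rejection.\<close>

lemma exp_1_151_ge: "(0.594 / 0.188::real) \<le> exp 1.151"
  using exp_ge_partial_sum[of "1.151" 9]
  by (simp add: lessThan_nat_numeral fact_numeral power_divide)

text \<open>Cutting the exponent into \<open>n\<close> pieces of size at most 1 makes the quadratic
  bound \<open>exp_bound\<close> applicable, and sharp for large \<open>n\<close>.\<close>

lemma exp_le_power:
  fixes x :: real
  assumes "0 \<le> x" "x \<le> real n" "0 < n"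
  shows "exp x \<le> (1 + x / real n + (x / real n)\<^sup>2) ^ n"
proof -
  have "exp x = exp (x / real n) ^ n"
    using assms by (simp flip: exp_of_nat_mult)
  also have "\<dots> \<le> (1 + x / real n + (x / real n)\<^sup>2) ^ n"
    using assms by (intro power_mono exp_bound) auto
  finally show ?thesis .
qed

lemma exp_one_le: "exp (1::real) \<le> 2.75"
  by (rule order_trans[OF exp_le_power[of 1 64]]) (simp_all add: power_divide)

lemma ln_0_594_le: "ln (0.594::real) \<le> - 0.518"
proof -
  have "exp (0.518::real) \<le> (1 + 0.518 / real 64 + (0.518 / real 64)\<^sup>2) ^ 64"
    by (rule exp_le_power) auto
  \<comment> \<open>The base is rounded up to keep the numbers in the 64th power short.\<close>
  also have "\<dots> \<le> 1.00816 ^ 64"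
    by (rule power_mono) (simp_all add: power2_eq_square)
  also have "\<dots> \<le> (1 / 0.594 :: real)"
    by (simp add: power_divide)
  finally have "exp (0.518::real) \<le> 1 / 0.594" .
  then have "(0.594::real) \<le> exp (- 0.518)"
    by (simp add: exp_minus field_simps)
  then have "ln (0.594::real) \<le> ln (exp (- 0.518))"
    by (subst ln_le_cancel_iff) auto
  then show ?thesis by simp
qed

text \<open>For a larger root, \<open>x = 1 - alpha_bot\<close> is below 0.594. Bounding
  \<open>ln x\<close> by -0.518 turns the equation into a linear inequality, increasing in
  \<open>x\<close>, that already fails at 0.594.\<close>

lemma alpha_bot_le: "alpha_bot \<le> 0.406"
proof (rule ccontr)
  assume "\<not> alpha_bot \<le> 0.406"
  define x where "x = 1 - alpha_bot"
  define K :: real where "K = 2 - 1 / exp 1"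
  have root: "0.405 < alpha_bot \<and> alpha_bot < 1 \<and>
      (1 - alpha_bot) * ln (1 - alpha_bot) + (2 - 1 / exp 1) * (1 - 2 * alpha_bot) = 0"
    unfolding alpha_bot_def by (rule theI'[OF alpha_bot_ex1])
  then have x: "0 < x" "x < 0.594" and eq: "x * ln x + K * (2 * x - 1) = 0"
    using \<open>\<not> alpha_bot \<le> 0.406\<close> unfolding x_def K_def by (simp_all add: algebra_simps)
  have K: "1 \<le> K" "K \<le> 1.6364"
    using exp_one_ge exp_one_le unfolding K_def by (simp_all add: field_simps)
  have "ln x \<le> ln 0.594" using x by (subst ln_le_cancel_iff) auto
  then have "x * ln x \<le> x * (- 0.518)"
    using ln_0_594_le x by (intro mult_left_mono) linarith+
  then have "0 \<le> x * (2 * K - 0.518) - K" using eq by (simp add: algebra_simps)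
  also have "\<dots> \<le> 0.594 * (2 * K - 0.518) - K"
    using x K by (intro diff_right_mono mult_right_mono) auto
  also have "\<dots> < 0" using K by simp
  finally show False by simp
qed

section \<open>Exponential decay of the gap\<close>

text \<open>The rate is at least the gap divided by \<open>B\<close>, so spending \<open>a\<close>
  multiplies a positive gap by at most \<open>1 - a / B\<close>, hence by at most
  \<open>exp (- a / B)\<close>.\<close>

lemma gap_step:
  fixes F y K t B a r :: real
  assumes "F - y \<le> K * exp (- t / B)" "F - y \<le> B * r"
    and "0 \<le> r" "0 \<le> a" "0 < B" "0 \<le> K"
  shows "F - (y + a * r) \<le> K * exp (- (t + a) / B)"
proof (cases "F \<le> y")
  case True
  then have "F - (y + a * r) \<le> 0" using assms by (simp add: add_increasing2)
  also have "0 \<le> K * exp (- (t + a) / B)" using assms by simp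
  finally show ?thesis .
next
  case False
  have "(F - y) / B \<le> r" using assms by (simp add: field_simps)
  then have "a * ((F - y) / B) \<le> a * r" using assms by (intro mult_left_mono) auto
  then have "F - (y + a * r) \<le> (F - y) * (1 + - a / B)"
    by (simp add: algebra_simps)
  also have "\<dots> \<le> (F - y) * exp (- a / B)"
    using False by (intro mult_left_mono exp_ge_add_one_self) auto
  also have "\<dots> \<le> K * exp (- t / B) * exp (- a / B)"
    using assms by (intro mult_right_mono) auto
  also have "\<dots> = K * exp (- (t + a) / B)"
    by (simp add: mult.assoc diff_divide_distrib flip: exp_add)
  finally show ?thesis .
qed

text \<open>The gap after spending \<open>t\<close> when the rate is governed by a target \<open>G\<close> of cost \<open>z\<close> up to cost
  \<open>z\<close>, and by a target \<open>F\<close> of cost \<open>b\<close> afterwards.\<close>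

definition two_phase_gap :: "real \<Rightarrow> real \<Rightarrow> real \<Rightarrow> real \<Rightarrow> real \<Rightarrow> real \<Rightarrow> bool" where
  "two_phase_gap F b G z y t \<longleftrightarrow>
     (t \<le> z \<longrightarrow> G - y \<le> G * exp (- t / z)) \<and>
     (z \<le> t \<longrightarrow> F - y \<le> (F - (1 - 1 / exp 1) * G) * exp (- (t - z) / b))"

lemma two_phase_gap_step:
  fixes F b G z y t a r :: real
  assumes gap: "two_phase_gap F b G z y t"
    and rate: "F - y \<le> b * r" "G - y \<le> z * r"
    and "0 \<le> r" "0 \<le> a" "0 < b" "0 < z" "0 \<le> G" "G \<le> F"
  shows "two_phase_gap F b G z (y + a * r) (t + a)"
proof -
  \<comment> \<open>\<open>K\<close> bounds the gap to \<open>F\<close> at cost \<open>z\<close>: by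
    then the first phase has collected at least \<open>(1 - 1 / exp 1) * G\<close>.\<close>
  define K where "K = F - (1 - 1 / exp 1) * G"
  have "(1 - 1 / exp 1) * G \<le> 1 * G"
    using \<open>0 \<le> G\<close> by (intro mult_right_mono) auto
  then have K: "0 \<le> K" using \<open>G \<le> F\<close> by (simp add: K_def)
  have first: "G - (y + a' * r) \<le> G * exp (- (t + a') / z)" if "t \<le> z" "0 \<le> a'" for a'
    using gap that assms by (intro gap_step) (auto simp: two_phase_gap_def)
  have "F - (y + a * r) \<le> K * exp (- (t + a - z) / b)" if "z \<le> t + a"
  proof (cases "z \<le> t")
    case True
    then have "F - (y + a * r) \<le> K * exp (- ((t - z) + a) / b)"
      using gap K assms by (intro gap_step) (auto simp: two_phase_gap_def K_def)
    then show ?thesis by (simp add: algebra_simps)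
  next
    case False
    \<comment> \<open>The element straddles cost \<open>z\<close> and is split there.\<close>
    define y' where "y' = y + (z - t) * r"
    have "G - y' \<le> G / exp 1"
      using first[of "z - t"] False \<open>0 < z\<close> by (simp add: y'_def exp_minus field_simps)
    then have "F - y' \<le> K * exp (- 0 / b)"
      by (simp add: K_def algebra_simps)
    moreover have "F - y' \<le> b * r"
      using rate(1) mult_nonneg_nonneg[of "z - t" r] False \<open>0 \<le> r\<close>
      unfolding y'_def by linarith
    ultimately have "F - (y' + (t + a - z) * r) \<le> K * exp (- (0 + (t + a - z)) / b)"
      using K that assms by (intro gap_step) auto
    then show ?thesis by (simp add: y'_def algebra_simps)
  qed
  with first[of a] \<open>0 \<le> a\<close> show ?thesis
    by (auto simp: two_phase_gap_def K_def)
qed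

section \<open>Runs of the greedy loop\<close>

locale knapsack_submodular =
  fixes V :: "'a set" and f :: "'a set \<Rightarrow> real" and c :: "'a \<Rightarrow> real" and b :: real
  assumes finite_V: "finite V"
    and mono_f: "mono_on (Pow V) f"
    and submodular_f: "submodular_on V f"
    and f_empty: "f {} = 0"
    and cost: "v \<in> V \<Longrightarrow> 0 < c v \<and> c v \<le> b"
begin

section \<open>Consequences of monotonicity and submodularity\<close>

lemma f_mono: "S \<subseteq> T \<Longrightarrow> T \<subseteq> V \<Longrightarrow> f S \<le> f T"
  using mono_f by (auto simp: mono_on_def)

lemma f_nonneg: "S \<subseteq> V \<Longrightarrow> 0 \<le> f S"
  using f_mono[of "{}" S] f_empty by simp

lemma f_submodular: "S \<subseteq> V \<Longrightarrow> T \<subseteq> V \<Longrightarrow> f (S \<union> T) + f (S \<inter> T) \<le> f S + f T"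
  using submodular_f by (simp add: submodular_on_def)

lemma cost_mono:
  assumes "S \<subseteq> T" "T \<subseteq> V"
  shows "sum c S \<le> sum c T"
proof (rule sum_mono2)
  show "finite T" using assms(2) finite_V by (rule finite_subset)
  show "0 \<le> c v" if "v \<in> T - S" for v
    using cost[of v] that assms(2) by auto
qed (rule assms(1))

lemma marginal_nonneg: "S \<subseteq> V \<Longrightarrow> v \<in> V \<Longrightarrow> 0 \<le> marginal f v S"
  using f_mono[of S "S \<union> {v}"] by (simp add: marginal_def subset_insertI)

lemma marginal_antimono:
  assumes "S \<subseteq> T" "T \<subseteq> V" "v \<in> V" "v \<notin> T"
  shows "marginal f v T \<le> marginal f v S"
proof -
  have "S \<union> {v} \<subseteq> V" using assms by auto
  then have "f (S \<union> {v}) + f T \<ge> f ((S \<union> {v}) \<union> T) + f ((S \<union> {v}) \<inter> T)"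
    using assms(2) by (intro f_submodular) auto
  moreover have "(S \<union> {v}) \<union> T = T \<union> {v}" "(S \<union> {v}) \<inter> T = S" using assms by auto
  ultimately show ?thesis by (simp add: marginal_def)
qed

lemma f_union_le:
  assumes "S \<subseteq> V" "T \<subseteq> V" "S \<inter> T = {}"
  shows "f (S \<union> T) - f S \<le> (\<Sum>v\<in>T. marginal f v S)"
proof -
  have "finite T" using assms finite_V finite_subset by blast
  then show ?thesis using assms
  proof (induction T)
    case empty
    then show ?case by simp
  next
    case (insert x T)
    have "marginal f x (S \<union> T) \<le> marginal f x S"
      using insert by (intro marginal_antimono) auto
    then show ?case using insert by (auto simp: marginal_def)
  qed
qed

lemma f_remove:
  assumes "T \<subseteq> V" "u \<in> T"
  shows "f T - f {u} \<le> f (T - {u})"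
proof -
  have "T - {u} \<subseteq> V" "{u} \<subseteq> V" using assms by auto
  then have "f (T - {u}) + f {u} \<ge> f ((T - {u}) \<union> {u}) + f ((T - {u}) \<inter> {u})"
    by (rule f_submodular)
  moreover have "(T - {u}) \<union> {u} = T" "(T - {u}) \<inter> {u} = {}" using assms by auto
  ultimately show ?thesis by (simp add: f_empty)
qed

section \<open>Rates and gap bounds along a run\<close>

abbreviation run :: "'a set \<times> 'a set \<Rightarrow> 'a set \<times> 'a set \<Rightarrow> bool" where
  "run \<equiv> (mgreedy_step f c b)\<^sup>*\<^sup>*"

text \<open>All of \<open>T - A\<close> is still available in \<open>W\<close>, so no density there
  exceeds that of \<open>u\<close>; by submodularity, the gap is at most the sum of the marginals
  over \<open>T - A\<close>.\<close>

lemma greedy_rate: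
  assumes u: "is_arg_max (\<lambda>v. marginal f v A / c v) (\<lambda>v. v \<in> W) u"
    and "A \<union> W \<subseteq> V" "T \<subseteq> A \<union> W" "sum c T \<le> B"
  shows "f T - f A \<le> B * (marginal f u A / c u)"
proof -
  define r where "r = marginal f u A / c u"
  have uW: "u \<in> W" and max: "\<And>v. v \<in> W \<Longrightarrow> marginal f v A / c v \<le> r"
    using u by (auto simp: is_arg_max_linorder r_def)
  have "0 \<le> r" unfolding r_def
    using uW assms(2) cost[of u] marginal_nonneg[of A u] by auto
  have TA: "T - A \<subseteq> W" "T \<subseteq> V" "A \<subseteq> V" using assms by auto
  have "f T \<le> f (A \<union> (T - A))" using TA by (intro f_mono) auto
  then have "f T - f A \<le> (\<Sum>v\<in>T - A. marginal f v A)"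
    using f_union_le[of A "T - A"] TA by (force simp del: Un_Diff_cancel)
  also have "\<dots> \<le> (\<Sum>v\<in>T - A. c v * r)"
  proof (rule sum_mono)
    fix v assume "v \<in> T - A"
    then have "v \<in> W" "0 < c v" using TA cost by auto
    then show "marginal f v A \<le> c v * r" using max[of v] by (simp add: field_simps)
  qed
  also have "\<dots> = sum c (T - A) * r" by (simp add: sum_distrib_right)
  also have "\<dots> \<le> B * r"
    using cost_mono[of "T - A" T] TA assms(4) \<open>0 \<le> r\<close> by (intro mult_right_mono) auto
  finally show ?thesis by (simp add: r_def)
qed

lemma run_wf:
  assumes "run ({}, V) (A, W)" "0 \<le> b"
  shows "A \<union> W \<subseteq> V \<and> A \<inter> W = {} \<and> sum c A \<le> b"
  using assms(1)
proof (induction "(A, W)" arbitrary: A W rule: rtranclp_induct)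
  case base
  then show ?case using assms(2) by simp
next
  case (step s A' W')
  from step(2) obtain A W u where s: "s = (A, W)"
    and u: "is_arg_max (\<lambda>v. marginal f v A / c v) (\<lambda>v. v \<in> W) u"
    and A': "A' = (if sum c A + c u \<le> b then A \<union> {u} else A)" and W': "W' = W - {u}"
    by (auto elim!: mgreedy_step.cases)
  have IH: "A \<union> W \<subseteq> V \<and> A \<inter> W = {} \<and> sum c A \<le> b" using step(3) s by blast
  have "u \<in> W" using u by (simp add: is_arg_max_def)
  moreover have "u \<notin> A" using IH \<open>u \<in> W\<close> by blast
  moreover have "finite A" using IH finite_V finite_subset by blast
  ultimately show ?case using IH by (auto simp: A' W')
qed

lemma run_subset:
  assumes "run (A, W) (A', W')"
  shows "A \<subseteq> A'"
  using assms
proof (induction "(A', W')" arbitrary: A' W' rule: rtranclp_induct)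
  case (step s)
  then show ?case by (auto elim!: mgreedy_step.cases split: if_splits)
qed simp

text \<open>In the step premise, \<open>a\<close> and \<open>r\<close> stand for the cost and the rate of the added element.\<close>

lemma run_invariant:
  assumes "run ({}, V) (A, W)" "T \<subseteq> A \<union> W" "0 \<le> b"
    and init: "P 0 0"
    and step_P: "\<And>y t a r. P y t \<Longrightarrow> 0 < a \<Longrightarrow> 0 \<le> r \<Longrightarrow>
      (\<And>U B. U \<subseteq> T \<Longrightarrow> sum c U \<le> B \<Longrightarrow> f U - y \<le> B * r) \<Longrightarrow> P (y + a * r) (t + a)"
  shows "P (f A) (sum c A)"
  using assms(1,2)
proof (induction "(A, W)" arbitrary: A W rule: rtranclp_induct)
  case base
  then show ?case using init f_empty by simp
next
  case (step s A' W')
  from step(2) obtain A W u where s: "s = (A, W)"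
    and u: "is_arg_max (\<lambda>v. marginal f v A / c v) (\<lambda>v. v \<in> W) u"
    and A': "A' = (if sum c A + c u \<le> b then A \<union> {u} else A)" and W': "W' = W - {u}"
    by (auto elim!: mgreedy_step.cases)
  have wf: "A \<union> W \<subseteq> V" "A \<inter> W = {}" using run_wf step(1) s assms(3) by auto
  have uW: "u \<in> W" using u by (simp add: is_arg_max_def)
  \<comment> \<open>The union of the two state components only shrinks along a run, so
    \<open>T\<close> was available before the step as well.\<close>
  then have TAW: "T \<subseteq> A \<union> W" using step(4) by (auto simp: A' W' split: if_splits)
  then have PA: "P (f A) (sum c A)" using step(3) s by blast
  have fA: "finite A" using wf finite_V finite_subset by blast
  have cu: "0 < c u" using cost uW wf by auto
  have "P (f A + c u * (marginal f u A / c u)) (sum c A + c u)"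
  proof (rule step_P[OF PA cu])
    show "0 \<le> marginal f u A / c u"
      using marginal_nonneg[of A u] wf uW cu by auto
    show "f U - f A \<le> B * (marginal f u A / c u)" if "U \<subseteq> T" "sum c U \<le> B" for U B
      using greedy_rate[OF u wf(1)] that TAW by blast
  qed
  moreover have "f A + c u * (marginal f u A / c u) = f (A \<union> {u})"
    using cu by (simp add: marginal_def)
  moreover have "u \<notin> A" using uW wf by blast
  then have "sum c (A \<union> {u}) = sum c A + c u" using fA by simp
  ultimately show ?case using PA by (simp add: A')
qed

text \<open>Allowing \<open>F\<close> below \<open>f T\<close> lets a mere lower estimate of the
  target value be used.\<close>

lemma run_gap:
  assumes "run ({}, V) (A, W)" "T \<subseteq> A \<union> W" "0 \<le> b"
    and "sum c T \<le> B" "0 < B" "0 \<le> F" "F \<le> f T"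
  shows "F - f A \<le> F * exp (- sum c A / B)"
proof (rule run_invariant[OF assms(1-3), where P = "\<lambda>y t. F - y \<le> F * exp (- t / B)"])
  fix y t a r :: real
  assume *: "F - y \<le> F * exp (- t / B)" "0 < a" "0 \<le> r"
    "\<And>U B. U \<subseteq> T \<Longrightarrow> sum c U \<le> B \<Longrightarrow> f U - y \<le> B * r"
  have "f T - y \<le> B * r" using *(4) assms(4) by blast
  then have "F - y \<le> B * r" using assms(7) by simp
  with * show "F - (y + a * r) \<le> F * exp (- (t + a) / B)"
    using assms by (intro gap_step) auto
qed simp

lemma run_two_phase_gap:
  assumes "run ({}, V) (A, W)" "T \<subseteq> A \<union> W"
    and "sum c T \<le> b" "0 < b" "U \<subseteq> T" "0 < sum c U" "0 \<le> G" "G \<le> f U" "G \<le> f T"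
  shows "two_phase_gap (f T) b G (sum c U) (f A) (sum c A)"
proof (rule run_invariant[OF assms(1,2)])
  show "0 \<le> b" using assms by simp
  show "two_phase_gap (f T) b G (sum c U) 0 0"
    using assms by (simp add: two_phase_gap_def)
next
  fix y t a r :: real
  assume *: "two_phase_gap (f T) b G (sum c U) y t" "0 < a" "0 \<le> r"
    "\<And>U B. U \<subseteq> T \<Longrightarrow> sum c U \<le> B \<Longrightarrow> f U - y \<le> B * r"
  have "G - y \<le> sum c U * r" using *(4)[OF assms(5) order_refl] assms by linarith
  with * show "two_phase_gap (f T) b G (sum c U) (y + a * r) (t + a)"
    using assms by (intro two_phase_gap_step) auto
qed

text \<open>The loop ends with no candidates left, so an element of \<open>T\<close> missing from
  \<open>Sg\<close> was rejected at some step; before the first such step \<open>T\<close> is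
  intact. An arbitrary start state allows a second application after \<open>u\<close> is
  discarded.\<close>

lemma first_rejected:
  assumes "run (S, W) (Sg, {})" "T \<subseteq> S \<union> W" "\<not> T \<subseteq> Sg"
  obtains A W' u where "run (S, W) (A, W')" "T \<subseteq> A \<union> W'" "u \<in> T" "u \<in> W'"
    "b < sum c A + c u" "run (A, W' - {u}) (Sg, {})" "run (S, W) (A, W' - {u})"
proof -
  have "\<exists>A W' u. run (S, W) (A, W') \<and> T \<subseteq> A \<union> W' \<and> u \<in> T \<and> u \<in> W' \<and>
    b < sum c A + c u \<and> run (A, W' - {u}) (Sg, {}) \<and> run (S, W) (A, W' - {u})"
    using assms(1,2)
  proof (induction "(S, W)" arbitrary: S W rule: converse_rtranclp_induct)
    case base
    then show ?case using assms(3) by simp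
  next
    case (step s)
    from step(1) obtain u where
      u: "is_arg_max (\<lambda>v. marginal f v S / c v) (\<lambda>v. v \<in> W) u"
      and s: "s = (if sum c S + c u \<le> b then S \<union> {u} else S, W - {u})"
      by (auto elim!: mgreedy_step.cases)
    have uW: "u \<in> W" using u by (simp add: is_arg_max_def)
    show ?case
    proof (cases "u \<in> T \<and> b < sum c S + c u")
      case True
      then have "s = (S, W - {u})" using s by simp
      then show ?thesis using True step uW by (metis r_into_rtranclp rtranclp.rtrancl_refl)
    next
      case False
      then have "T \<subseteq> fst s \<union> snd s" using step(4) s by auto
      then obtain A W' v where "run s (A, W')" "T \<subseteq> A \<union> W'" "v \<in> T" "v \<in> W'"
        "b < sum c A + c v" "run (A, W' - {v}) (Sg, {})" "run s (A, W' - {v})"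
        using step(3)[of "fst s" "snd s"] by auto
      then show ?thesis using step(1) by (meson converse_rtranclp_into_rtranclp)
    qed
  qed
  then show thesis using that by blast
qed

section \<open>Contradiction from two rejected elements of a feasible set\<close>

lemma greedy_or_single_ge:
  assumes Sg: "run ({}, V) (Sg, {})"
    and X: "X \<subseteq> V" "sum c X \<le> b"
    and less: "f Sg < 0.406 * f X"
  shows "\<exists>v\<in>V. 0.406 * f X \<le> f {v}"
proof (rule ccontr)
  assume "\<not> ?thesis"
  then have single: "\<And>v. v \<in> V \<Longrightarrow> f {v} < 0.406 * f X" by force
  define F where "F = f X"
  have b0: "0 \<le> b" using X cost_mono[of "{}" X] by simp
  have SgV: "Sg \<subseteq> V" using run_wf[OF Sg b0] by auto
  have "X \<noteq> {}" using less f_nonneg[OF SgV] f_empty by auto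
  then have b: "0 < b" using X cost by force
  have F: "0 < F" using less f_nonneg[OF SgV] by (simp add: F_def)
  have "\<not> X \<subseteq> Sg" using f_mono[of X Sg] SgV less F by (auto simp: F_def)
  then obtain A W u where A: "run ({}, V) (A, W)" "X \<subseteq> A \<union> W" "u \<in> X" "u \<in> W"
    "b < sum c A + c u" "run (A, W - {u}) (Sg, {})" "run ({}, V) (A, W - {u})"
    using first_rejected[OF Sg, of X] X by auto
  have A_wf: "A \<inter> W = {}" "A \<subseteq> V" using run_wf[OF A(1)] b by auto
  have fA: "f A < 0.406 * F"
    using f_mono[OF run_subset[OF A(6)] SgV] less by (simp add: F_def)

  have "F - f A \<le> F * exp (- sum c A / b)"
    using run_gap[OF A(1,2), of b F] X b F by (simp add: F_def)
  then have "F * 0.594 < F * exp (- sum c A / b)" using fA by simp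
  then have "0.594 < exp (- sum c A / b)" using F by simp
  moreover have "exp (- 0.521) \<le> (0.594::real)"
    using exp_0_521_ge by (simp add: exp_minus field_simps)
  ultimately have "exp (- 0.521) < exp (- sum c A / b)" by linarith
  then have cA: "sum c A < 0.521 * b" using b by (simp add: field_simps)

  define X1 where "X1 = X - {u}"
  have X1: "X1 \<subseteq> V" "X1 \<subseteq> A \<union> (W - {u})" using X A(2) by (auto simp: X1_def)
  have "f X - f {u} \<le> f X1" unfolding X1_def using f_remove X A(3) by blast
  then have fX1: "0.594 * F \<le> f X1" using single[of u] A(3) X by (auto simp: F_def)
  have "finite X" using X finite_V finite_subset by blast
  then have cX1: "sum c X1 = sum c X - c u" using A(3) by (simp add: X1_def sum_diff1)
  \<comment> \<open>Since 0.594 > 0.406, the set \<open>X1\<close> is too valuable to be contained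
    in \<open>Sg\<close>, which forces a second rejection.\<close>
  have "\<not> X1 \<subseteq> Sg" using f_mono[of X1 Sg] SgV less F fX1 by (auto simp: F_def)
  then obtain A' W' w where A': "run (A, W - {u}) (A', W')" "X1 \<subseteq> A' \<union> W'" "w \<in> X1"
    "w \<in> W'" "b < sum c A' + c w" "run (A', W' - {w}) (Sg, {})" "run (A, W - {u}) (A', W' - {w})"
    by (rule first_rejected[OF A(6) X1(2)])
  have run_A': "run ({}, V) (A', W')" using A(7) A'(1) by simp
  have fA': "f A' < 0.406 * F"
    using f_mono[OF run_subset[OF A'(6)] SgV] less by (simp add: F_def)
  have "w \<in> V" using A'(3) X1 by auto
  \<comment> \<open>\<open>B\<close> is the budget left beside \<open>u\<close>: it bounds the cost
    of \<open>X1\<close>, and the overflow at \<open>u\<close> makes it smaller than the cost of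
    \<open>A\<close>.\<close>
  define B where "B = b - c u"
  have "c w \<le> sum c X1"
    using cost_mono[of "{w}" X1] A'(3) X1 by simp
  then have B: "0 < B" "sum c X1 \<le> B" "B < sum c A"
    using cX1 X cost[OF \<open>w \<in> V\<close>] A(5) by (auto simp: B_def)
  have "0.594 * F - f A' \<le> 0.594 * F * exp (- sum c A' / B)"
    using run_gap[OF run_A' A'(2), of B "0.594 * F"] B b F fX1 by simp
  then have "F * 0.188 < F * (0.594 * exp (- sum c A' / B))" using fA' by simp
  then have "0.188 < 0.594 * exp (- sum c A' / B)" using F by (subst (asm) mult_less_cancel_left_pos)
  moreover have "0.594 * exp (- 1.151) \<le> (0.188::real)"
    using exp_1_151_ge by (simp add: exp_minus field_simps)
  ultimately have "0.594 * exp (- 1.151) < 0.594 * exp (- sum c A' / B)"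
    by (rule le_less_trans[rotated])
  then have "sum c A' < 1.151 * B" using B by (simp add: field_simps)
  \<comment> \<open>The product 1.151 * 0.521 is just below 0.6.\<close>
  then have cw: "0.4 * b < c w" using A'(5) B(3) cA b by simp

  define X2 where "X2 = X1 - {w}"
  have X2: "X2 \<subseteq> X" "X2 \<subseteq> V" using X by (auto simp: X1_def X2_def)
  have "f X1 - f {w} \<le> f X2" unfolding X2_def using f_remove X1 A'(3) by blast
  then have fX2: "0.188 * F \<le> f X2" using single[OF \<open>w \<in> V\<close>] fX1 by (simp add: F_def)
  then have "X2 \<noteq> {}" using f_empty F by auto
  moreover have "finite X2" using X2 finite_V finite_subset by blast
  ultimately have z: "0 < sum c X2" using cost X2 by (intro sum_pos) auto
  have "finite X1" using X1 finite_V finite_subset by blast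
  then have "sum c X2 = sum c X1 - c w" using A'(3) by (simp add: X2_def sum_diff1)
  then have z_less: "sum c X2 + 0.4 * b < sum c A" using B cw by simp
  \<comment> \<open>The bound is taken at \<open>A\<close>, before any element of \<open>X\<close>
    is rejected, so both \<open>X2\<close> and \<open>X\<close> are valid targets.\<close>
  have "two_phase_gap (f X) b (0.188 * F) (sum c X2) (f A) (sum c A)"
    using run_two_phase_gap[OF A(1,2) X(2) b X2(1) z, of "0.188 * F"] F fX2 by (simp add: F_def)
  then have gap: "F - f A \<le> (F - (1 - 1 / exp 1) * (0.188 * F)) * exp (- (sum c A - sum c X2) / b)"
    using z_less b by (simp add: two_phase_gap_def F_def)
  have e: "1 / exp 1 \<le> (0.368::real)" using exp_one_ge by (simp add: field_simps)
  \<comment> \<open>The constant 0.881184 is 1 - 0.632 * 0.188, with 0.632 a lower bound for 1 -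
    1/e.\<close>
  have "(F - (1 - 1 / exp 1) * (0.188 * F)) * exp (- (sum c A - sum c X2) / b)
      \<le> (F * 0.881184) * exp (- 0.4)"
  proof (rule mult_mono)
    have "F * (1 - (1 - 1 / exp 1) * 0.188) \<le> F * 0.881184"
      using e F by (intro mult_left_mono) auto
    then show "F - (1 - 1 / exp 1) * (0.188 * F) \<le> F * 0.881184" by (simp add: algebra_simps)
    show "exp (- (sum c A - sum c X2) / b) \<le> exp (- 0.4)"
      using z_less b by (simp add: field_simps)
  qed (use F in auto)
  also have "\<dots> \<le> F * 0.594"
    using exp_0_4_ge F by (simp add: exp_minus field_simps)
  finally show False using gap fA by simp
qed

end

section \<open>The approximation factor\<close>

theorem theorem2p1:
  fixes V :: "'a set" and f :: "'a set \<Rightarrow> real" and c :: "'a \<Rightarrow> real" and b :: real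
    and OPT S\<^sub>m :: "'a set"
  assumes "finite V"
    and "mono_on (Pow V) f"
    and "submodular_on V f"
    and "f {} = 0"
    and "\<forall>v\<in>V. 0 < c v \<and> c v \<le> b"
    and "optimal_solution V f c b OPT"
    and "mgreedy_output V f c b S\<^sub>m"
  shows "sum c S\<^sub>m \<le> b \<and> f S\<^sub>m \<ge> alpha_bot * f OPT"
proof -
  interpret knapsack_submodular V f c b
    using assms by unfold_locales auto
  obtain Sg v where Sg: "run ({}, V) (Sg, {})"
    and v: "v \<in> V" "\<And>x. x \<in> V \<Longrightarrow> f {x} \<le> f {v}"
    and Sm: "S\<^sub>m \<in> {{v}, Sg}" "f {v} \<le> f S\<^sub>m" "f Sg \<le> f S\<^sub>m"
    using assms(7) unfolding mgreedy_output_def is_arg_max_linorder by auto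
  have X: "OPT \<subseteq> V" "sum c OPT \<le> b"
    using assms(6) unfolding optimal_solution_def is_arg_max_def by auto
  have b: "0 \<le> b" using cost[OF v(1)] by simp
  have "sum c S\<^sub>m \<le> b" using Sm(1) run_wf[OF Sg b] cost[OF v(1)] by auto
  moreover have "0.406 * f OPT \<le> f S\<^sub>m"
  proof (cases "f Sg < 0.406 * f OPT")
    case True
    then obtain x where "x \<in> V" "0.406 * f OPT \<le> f {x}"
      using greedy_or_single_ge[OF Sg X] by blast
    then show ?thesis using v(2)[of x] Sm(2) by linarith
  qed (use Sm(3) in linarith)
  moreover have "alpha_bot * f OPT \<le> 0.406 * f OPT"
    using alpha_bot_le f_nonneg[OF X(1)] by (rule mult_right_mono)
  ultimately show ?thesis by linarith
qed

end
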